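(* Let $[a,b]$ be a bounded real interval with $a<b$, let $\sigma:\mathbb{R}\to\mathbb{R}$ be a non-decreasing sigmoidal function satisfying $(\Sigma 1)$, $(\Sigma 2)$ and $(\Sigma 3)$, and let $\varphi$ be a convex $\varphi$-function. Let $f\in L^{\varphi}_+([a,b])$ be fixed. Then there exists $\lambda>0$ such that $$\lim_{n\to+\infty} I^{\varphi}\left[\lambda\left(K^{(M)}_n(f,\cdot)-f(\cdot)\right)\right]=0.$$
   Context: A $\varphi$-function is a function $\varphi:[0,+\infty)\to[0,+\infty)$ such that $\varphi(0)=0$, $\varphi(u)>0$ for every $u>0$, $\varphi$ is continuous and non-decreasing, and $\lim_{u\to+\infty}\varphi(u)=+\infty$. Let $M([a,b])$ be the set of Lebesgue measurable functions $f:[a,b]\to\mathbb{R}$. The modular is $I^{\varphi}[f]:=\int_a^b\varphi(|f(x)|)\,dx\in[0,+\infty]$ for $f\in M([a,b])$. The Orlicz space is $L^{\varphi}([a,b]):=\{f\in M([a,b]): I^{\varphi}[\lambda f]<+\infty \text{ for some } \lambda>0\}$, and $L^{\varphi}_+([a,b])$ is the set of its non-negative elements. A measurable function $\sigma:\mathbb{R}\to\mathbb{R}$ is sigmoidal if $\lim_{x\to-\infty}\sigma(x)=0$ and $\lim_{x\to+\infty}\sigma(x)=1$. Put $\phi_\sigma(x):=\frac12[\sigma(x+1)-\sigma(x-1)]$, $x\in\mathbb{R}$. The conditions are: $(\Sigma 1)$ $\sigma(x)-1/2$ is an odd function; $(\Sigma 2)$ $\phi_\sigma(x)$ is non-decreasing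 for $x<0$ and non-increasing for $x\geq 0$; $(\Sigma 3)$ $\sigma(x)=\mathcal{O}(|x|^{-\alpha})$ as $x\to-\infty$, for some $\alpha>0$. For $n\in\mathbb{N}^+$ let $\mathcal{J}_n:=\{k\in\mathbb{Z}: \lceil na\rceil\leq k\leq\lfloor nb\rfloor-1\}$. For $n$ such that $\lceil na\rceil\leq\lfloor nb\rfloor-1$ (which holds for all sufficiently large $n$), the max-product neural network operator of Kantorovich type activated by $\sigma$ is $$K^{(M)}_n(f,x):=\frac{\bigvee_{k\in\mathcal{J}_n}\left[n\int_{k/n}^{(k+1)/n}f(u)\,du\right]\phi_\sigma(nx-k)}{\bigvee_{k\in\mathcal{J}_n}\phi_\sigma(nx-k)},\qquad x\in[a,b],$$ where $\bigvee_{k\in\mathcal{J}}A_k:=\sup\{A_k: k\in\mathcal{J}\}$. *)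

theory Defs
  imports "HOL-Analysis.Analysis" "HOL-Library.Landau_Symbols"
begin

text \<open>
  A function \<open>\<phi> : [0,\<infinity>) \<rightarrow> [0,\<infinity>)\<close> is modelled by a total function on the reals;
  only its values on \<open>{0..}\<close> are ever constrained or used. Likewise, functions on \<open>[a,b]\<close> are
  total functions whose values outside \<open>{a..b}\<close> are irrelevant.
\<close>

definition phi_function :: "(real \<Rightarrow> real) \<Rightarrow> bool" where
  "phi_function \<phi> \<longleftrightarrow>
     \<phi> ` {0..} \<subseteq> {0..} \<and> \<phi> 0 = 0 \<and> (\<forall>u>0. \<phi> u > 0) \<and>
     continuous_on {0..} \<phi> \<and> mono_on {0..} \<phi> \<and> filterlim \<phi> at_top at_top"

definition modular :: "(real \<Rightarrow> real) \<Rightarrow> real \<Rightarrow> real \<Rightarrow> (real \<Rightarrow> real) \<Rightarrow> ennreal" where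
  "modular \<phi> a b f = (\<integral>\<^sup>+x. ennreal (\<phi> \<bar>f x\<bar>) \<partial>lebesgue_on {a..b})"

definition orlicz_space :: "(real \<Rightarrow> real) \<Rightarrow> real \<Rightarrow> real \<Rightarrow> (real \<Rightarrow> real) set" where
  "orlicz_space \<phi> a b =
     {f \<in> borel_measurable (lebesgue_on {a..b}). \<exists>c>0. modular \<phi> a b (\<lambda>x. c * f x) < \<infinity>}"

definition orlicz_space_nonneg :: "(real \<Rightarrow> real) \<Rightarrow> real \<Rightarrow> real \<Rightarrow> (real \<Rightarrow> real) set" where
  "orlicz_space_nonneg \<phi> a b = {f \<in> orlicz_space \<phi> a b. \<forall>x\<in>{a..b}. f x \<ge> 0}"

definition sigmoidal :: "(real \<Rightarrow> real) \<Rightarrow> bool" where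
  "sigmoidal \<sigma> \<longleftrightarrow>
     \<sigma> \<in> borel_measurable lebesgue \<and> (\<sigma> \<longlongrightarrow> 0) at_bot \<and> (\<sigma> \<longlongrightarrow> 1) at_top"

definition phi_sigma :: "(real \<Rightarrow> real) \<Rightarrow> real \<Rightarrow> real" where
  "phi_sigma \<sigma> x = (\<sigma> (x + 1) - \<sigma> (x - 1)) / 2"

definition Sigma1 :: "(real \<Rightarrow> real) \<Rightarrow> bool" where
  "Sigma1 \<sigma> \<longleftrightarrow> (\<forall>x. \<sigma> (- x) - 1/2 = - (\<sigma> x - 1/2))"

definition Sigma2 :: "(real \<Rightarrow> real) \<Rightarrow> bool" where
  "Sigma2 \<sigma> \<longleftrightarrow> mono_on {..<0} (phi_sigma \<sigma>) \<and> antimono_on {0..} (phi_sigma \<sigma>)"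

definition Sigma3 :: "(real \<Rightarrow> real) \<Rightarrow> bool" where
  "Sigma3 \<sigma> \<longleftrightarrow> (\<exists>\<alpha>>0. \<sigma> \<in> O[at_bot](\<lambda>x. \<bar>x\<bar> powr (- \<alpha>)))"

definition index_set :: "real \<Rightarrow> real \<Rightarrow> nat \<Rightarrow> int set" where
  "index_set a b n = {\<lceil>real n * a\<rceil>..\<lfloor>real n * b\<rfloor> - 1}"

text \<open>
  The suprema are over finite sets, nonempty for all large \<open>n\<close>; for the remaining \<open>n\<close> the value
  is unspecified. The denominator can vanish only when \<open>phi_sigma \<sigma> 2 = 0\<close>, and then only for \<open>x\<close>
  within \<open>1/n\<close> of \<open>b\<close> (take \<open>\<sigma>\<close> to be a step function); there the quotient is 0
  by the convention \<open>y / 0 = 0\<close>.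
\<close>

definition max_product_kantorovich ::
    "(real \<Rightarrow> real) \<Rightarrow> real \<Rightarrow> real \<Rightarrow> nat \<Rightarrow> (real \<Rightarrow> real) \<Rightarrow> real \<Rightarrow> real" where
  "max_product_kantorovich \<sigma> a b n f x =
     (SUP k\<in>index_set a b n.
        (real n * (LINT u:{of_int k / real n..(of_int k + 1) / real n}|lebesgue. f u))
          * phi_sigma \<sigma> (real n * x - of_int k)) /
     (SUP k\<in>index_set a b n. phi_sigma \<sigma> (real n * x - of_int k))"

end

theory Submission
  imports Defs
begin

text \<open>
  Write \<open>K\<^sub>n f\<close> for the operator. The proof is a density argument, and it rests on one estimate:
  the operators are bounded for the modular, uniformly in \<open>n\<close>, even though they are not linear.

  On \<open>[a,b]\<close> one has \<open>K\<^sub>n f x = max\<^sub>k (A\<^sub>k * r\<^sub>k(x))\<close>, where \<open>A\<^sub>k\<close> is the mean of \<open>f\<close> over the cell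
  \<open>[k/n,(k+1)/n]\<close> and the weight \<open>r\<^sub>k(x) = phi_sigma \<sigma> (n x - k) / max\<^sub>j phi_sigma \<sigma> (n x - j)\<close> lies in
  \<open>[0,1]\<close>. A convex \<open>\<psi>\<close> vanishing at \<open>0\<close> satisfies \<open>\<psi> (r A) \<le> r \<psi> A\<close>, so evaluating at the
  maximizing index and then adding the other, non-negative, terms gives
  \<open>\<psi> (K\<^sub>n f x) \<le> \<Sum>\<^sub>k \<psi> (A\<^sub>k) r\<^sub>k(x)\<close>. Jensen's inequality bounds \<open>\<psi> (A\<^sub>k)\<close> by the mean of \<open>\<psi> f\<close> over
  the cell, and \<open>\<integral> r\<^sub>k \<le> C / n\<close>, because \<open>phi_sigma \<sigma>\<close> is a difference of two shifts of a bounded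
  monotone function and therefore has integral at most \<open>1\<close>, while the maximum in the denominator is at
  least \<open>phi_sigma \<sigma> 1 > 0\<close> except close to \<open>b\<close>. Summing over the cells yields
  \<open>I[K\<^sub>n f] \<le> 2 C I[f]\<close> (lemma \<open>kantorovich_modular_le\<close>). Close to \<open>b\<close> that maximum
  may be arbitrarily small or vanish; this costs nothing, since \<open>r\<^sub>k \<le> 1\<close> and the exceptional
  strip has length at most \<open>1/n\<close>.

  For a bounded continuous \<open>g \<ge> 0\<close>, \<open>K\<^sub>n g \<rightarrow> g\<close> pointwise on \<open>[a,b)\<close>: the weights of the cells far from
  \<open>x\<close> tend to \<open>0\<close>, and the index of weight \<open>1\<close> belongs to a cell close to \<open>x\<close>. As \<open>0 \<le> K\<^sub>n g \<le> sup g\<close>,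
  dominated convergence gives \<open>I[K\<^sub>n g - g] \<rightarrow> 0\<close>.

  Finally \<open>\<bar>K\<^sub>n f - K\<^sub>n g\<bar> \<le> K\<^sub>n \<bar>f - g\<bar>\<close>, because a maximum is subadditive. Approximating \<open>f\<close> in the
  modular by a bounded continuous \<open>g\<close> and splitting
  \<open>K\<^sub>n f - f = (K\<^sub>n f - K\<^sub>n g) + (K\<^sub>n g - g) + (g - f)\<close> proves the theorem. The modular is not
  homogeneous; convexity turns each splitting into a loss of a factor in \<open>\<lambda>\<close>: \<open>2\<close> for the approximation
  (truncation, then continuity) and \<open>3\<close> for the three summands, whence \<open>\<lambda> = c\<^sub>0 / 6\<close> if
  \<open>I[c\<^sub>0 f] < \<infinity>\<close>.
\<close>

section \<open>Convex modulars and integration\<close>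

text \<open>
  Extending \<open>\<phi>\<close> evenly to the whole line gives a convex function on an open set, to which supporting
  lines and continuity apply; monotonicity of \<open>\<phi>\<close> is what makes the even extension convex.
\<close>

lemma phi_function_even_extension:
  assumes phi: "phi_function \<phi>" and conv: "convex_on {0..} \<phi>"
  shows "convex_on UNIV (\<lambda>u. \<phi> \<bar>u\<bar>)"
    and "continuous_on UNIV (\<lambda>u. \<phi> \<bar>u\<bar>)"
    and "\<And>u. 0 \<le> \<phi> \<bar>u\<bar>"
    and "\<And>u v. \<bar>u\<bar> \<le> \<bar>v\<bar> \<Longrightarrow> \<phi> \<bar>u\<bar> \<le> \<phi> \<bar>v\<bar>"
proof -
  from phi have cont: "continuous_on {0..} \<phi>" and mono: "mono_on {0..} \<phi>"
    and range: "\<phi> ` {0..} \<subseteq> {0..}"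
    by (auto simp: phi_function_def)
  show mono': "\<phi> \<bar>u\<bar> \<le> \<phi> \<bar>v\<bar>" if "\<bar>u\<bar> \<le> \<bar>v\<bar>" for u v
    using mono_onD[OF mono, of "\<bar>u\<bar>" "\<bar>v\<bar>"] that by simp
  show "0 \<le> \<phi> \<bar>u\<bar>" for u
    using range by (auto simp: image_subset_iff)
  show "continuous_on UNIV (\<lambda>u. \<phi> \<bar>u\<bar>)"
    by (rule continuous_on_compose2[OF cont]) (auto intro: continuous_intros)
  show "convex_on UNIV (\<lambda>u. \<phi> \<bar>u\<bar>)"
  proof (rule convex_onI)
    fix t u v :: real assume t: "0 < t" "t < 1"
    have "\<bar>(1 - t) *\<^sub>R u + t *\<^sub>R v\<bar> \<le> (1 - t) * \<bar>u\<bar> + t * \<bar>v\<bar>"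
      using t by (auto intro!: order_trans[OF abs_triangle_ineq] simp: abs_mult)
    then have "\<phi> \<bar>(1 - t) *\<^sub>R u + t *\<^sub>R v\<bar> \<le> \<phi> ((1 - t) *\<^sub>R \<bar>u\<bar> + t *\<^sub>R \<bar>v\<bar>)"
      using mono'[of "(1 - t) *\<^sub>R u + t *\<^sub>R v" "(1 - t) * \<bar>u\<bar> + t * \<bar>v\<bar>"] t by auto
    also have "\<dots> \<le> (1 - t) * \<phi> \<bar>u\<bar> + t * \<phi> \<bar>v\<bar>"
      using convex_onD[OF conv, of t "\<bar>u\<bar>" "\<bar>v\<bar>"] t by simp
    finally show "\<phi> \<bar>(1 - t) *\<^sub>R u + t *\<^sub>R v\<bar> \<le> (1 - t) * \<phi> \<bar>u\<bar> + t * \<phi> \<bar>v\<bar>" .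
  qed simp
qed

lemma convex_scale_le:
  fixes \<psi> :: "real \<Rightarrow> real"
  assumes "convex_on UNIV \<psi>" "\<psi> 0 = 0" "0 \<le> t" "t \<le> 1"
  shows "\<psi> (t * u) \<le> t * \<psi> u"
  using convex_onD[OF assms(1), of t 0 u] assms(2-) by simp

lemma convex_mean3_le:
  fixes \<psi> :: "real \<Rightarrow> real"
  assumes "convex_on UNIV \<psi>"
  shows "\<psi> ((u + v + w) / 3) \<le> (\<psi> u + \<psi> v + \<psi> w) / 3"
proof -
  have "(u + v + w) / 3 = (1 - 1/3) *\<^sub>R ((1 - 1/2) *\<^sub>R u + (1/2) *\<^sub>R v) + (1/3) *\<^sub>R w"
    by (simp add: field_simps)
  also have "\<psi> \<dots> \<le> (1 - 1/3) * \<psi> ((1 - 1/2) *\<^sub>R u + (1/2) *\<^sub>R v) + 1/3 * \<psi> w"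
    by (rule convex_onD[OF assms]) auto
  also have "\<psi> ((1 - 1/2) *\<^sub>R u + (1/2) *\<^sub>R v) \<le> (1 - 1/2) * \<psi> u + 1/2 * \<psi> v"
    by (rule convex_onD[OF assms]) auto
  finally show ?thesis by (simp add: field_simps)
qed

text \<open>
  Jensen's inequality for the mean over an interval. The right-hand side is a non-negative integral and
  may be infinite, so that the composition need not be integrable. When it is finite, integrate the
  supporting line of \<open>\<psi>\<close> at the mean: its linear part integrates to zero.
\<close>

lemma jensen_interval:
  fixes \<psi> h :: "real \<Rightarrow> real"
  assumes conv: "convex_on UNIV \<psi>" and nonneg: "\<And>u. 0 \<le> \<psi> u"
    and h: "set_integrable lebesgue {p..q} h" and "p < q"
  shows "ennreal (\<psi> ((LINT u:{p..q}|lebesgue. h u) / (q - p)))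
           \<le> ennreal (1 / (q - p)) * (\<integral>\<^sup>+u\<in>{p..q}. ennreal (\<psi> (h u)) \<partial>lebesgue)"
    (is "?lhs \<le> _ * ?N")
proof (cases "?N = \<infinity>")
  case True
  then show ?thesis using \<open>p < q\<close> by (simp add: ennreal_mult_top)
next
  case False
  define A where "A = (LINT u:{p..q}|lebesgue. h u)"
  define m where "m = A / (q - p)"
  \<comment> \<open>The right derivative of \<open>\<psi>\<close> at \<open>m\<close>, the slope of a supporting line.\<close>
  define s where "s = Inf ((\<lambda>t. (\<psi> m - \<psi> t) / (m - t)) ` ({m<..} \<inter> UNIV))"
  have line: "\<psi> m + s * (y - m) \<le> \<psi> y" for y
    unfolding s_def by (rule convex_le_Inf_differential[OF conv]) auto
  have cont: "continuous_on UNIV \<psi>"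
    by (rule convex_on_continuous[OF open_UNIV conv])
  have hm: "h \<in> borel_measurable (lebesgue_on {p..q})"
    using h unfolding set_integrable_def by (subst (asm) integrable_restrict_space[symmetric]) auto
  have psih: "set_integrable lebesgue {p..q} (\<lambda>u. \<psi> (h u))"
  proof -
    have "integrable (lebesgue_on {p..q}) (\<lambda>u. \<psi> (h u))"
    proof (rule integrableI_nonneg)
      show "(\<lambda>u. \<psi> (h u)) \<in> borel_measurable (lebesgue_on {p..q})"
        using measurable_compose[OF hm borel_measurable_continuous_onI[OF cont]] .
      show "(\<integral>\<^sup>+u. ennreal (\<psi> (h u)) \<partial>lebesgue_on {p..q}) < \<infinity>"
        using False by (subst nn_integral_restrict_space) (auto simp: top.not_eq_extremum)
    qed (simp add: nonneg)
    then show ?thesis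
      unfolding set_integrable_def by (subst (asm) integrable_restrict_space) auto
  qed
  have const: "set_integrable lebesgue {p..q} (\<lambda>u. r)" for r :: real
    using \<open>p < q\<close> by (auto simp: set_integrable_def emeasure_lborel_Icc)
  have "(q - p) * \<psi> m = (LINT u:{p..q}|lebesgue. \<psi> m - s * m + s * h u)"
  proof -
    have "(LINT u:{p..q}|lebesgue. \<psi> m - s * m + s * h u)
        = (LINT u:{p..q}|lebesgue. \<psi> m - s * m) + (LINT u:{p..q}|lebesgue. s * h u)"
      by (rule set_integral_add(2)) (use h const in auto)
    also have "(LINT u:{p..q}|lebesgue. s * h u) = s * A"
      unfolding A_def by simp
    also have "(LINT u:{p..q}|lebesgue. \<psi> m - s * m) = (q - p) * (\<psi> m - s * m)"
      using \<open>p < q\<close> by (subst set_lebesgue_integral_def) simp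
    also have "(q - p) * (\<psi> m - s * m) + s * A = (q - p) * \<psi> m"
      using \<open>p < q\<close> by (simp add: m_def field_simps)
    finally show ?thesis by simp
  qed
  also have "\<dots> \<le> (LINT u:{p..q}|lebesgue. \<psi> (h u))"
  proof (rule set_integral_mono)
    show "set_integrable lebesgue {p..q} (\<lambda>u. \<psi> m - s * m + s * h u)"
      by (rule set_integral_add(1)) (use h const in auto)
    show "\<psi> m - s * m + s * h u \<le> \<psi> (h u)" for u
      using line[of "h u"] by (simp add: algebra_simps)
  qed (rule psih)
  finally have "\<psi> m \<le> 1 / (q - p) * (LINT u:{p..q}|lebesgue. \<psi> (h u))"
    using \<open>p < q\<close> by (simp add: field_simps)
  then have "ennreal (\<psi> m) \<le> ennreal (1 / (q - p)) * ennreal (LINT u:{p..q}|lebesgue. \<psi> (h u))"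
    using \<open>p < q\<close> by (subst ennreal_mult'[symmetric]) (auto intro!: ennreal_leI)
  also have "ennreal (LINT u:{p..q}|lebesgue. \<psi> (h u)) = ?N"
    using psih unfolding set_integrable_def set_lebesgue_integral_def
    by (subst nn_integral_eq_integral[symmetric])
      (auto simp: nonneg intro!: nn_integral_cong split: split_indicator)
  finally show ?thesis by (simp add: m_def A_def)
qed

lemma borel_measurable_lebesgue_onI:
  "h \<in> borel_measurable borel \<Longrightarrow> h \<in> borel_measurable (lebesgue_on S)"
  by (intro measurable_restrict_space1 measurable_completion) simp

lemma nn_integral_const_lebesgue_on_Icc: "(\<integral>\<^sup>+x. ennreal c \<partial>lebesgue_on {a..b::real}) < \<infinity>"
proof -
  have "finite_measure (lebesgue_on {a..b})"
    by (rule finite_measure_lebesgue_on) simp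
  then have "emeasure (lebesgue_on {a..b}) (space (lebesgue_on {a..b})) < top"
    by (intro finite_measure.finite_emeasure_space[THEN top.not_eq_extremum[THEN iffD1]])
  then show ?thesis
    unfolding nn_integral_const infinity_ennreal_def by (intro ennreal_mult_less_top[THEN iffD2]) simp
qed

lemma AE_lebesgue_on_Ico: "AE x in lebesgue_on {a..b::real}. x \<in> {a..<b}"
proof -
  have "AE x in lebesgue. x \<noteq> b"
    by (rule AE_completion[OF AE_lborel_singleton])
  then show ?thesis
    by (subst AE_restrict_space_iff) auto
qed

text \<open>
  Convexity forces at least linear growth, \<open>\<bar>v\<bar> \<le> 1 + \<phi> \<bar>v\<bar> / \<phi> 1\<close>, so on a bounded interval a finite
  modular implies Lebesgue integrability. This is what gives the cell means a meaning.
\<close>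

lemma finite_modular_imp_integrable:
  fixes a b :: real and f :: "real \<Rightarrow> real"
  assumes phi: "phi_function \<phi>" and conv: "convex_on {0..} \<phi>"
    and f: "f \<in> borel_measurable (lebesgue_on {a..b})" "\<And>x. x \<in> {a..b} \<Longrightarrow> 0 \<le> f x"
    and c0: "0 < c\<^sub>0" and fin: "(\<integral>\<^sup>+x. ennreal (\<phi> \<bar>c\<^sub>0 * f x\<bar>) \<partial>lebesgue_on {a..b}) < \<infinity>"
  shows "integrable (lebesgue_on {a..b}) f"
proof -
  let ?M = "lebesgue_on {a..b}"
  note ext = phi_function_even_extension[OF phi conv]
  have pos: "0 < \<phi> 1" using phi by (simp add: phi_function_def)
  have growth: "\<bar>v\<bar> \<le> 1 + 1 / \<phi> 1 * \<phi> \<bar>v\<bar>" for v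
  proof (cases "\<bar>v\<bar> \<le> 1")
    case True
    then show ?thesis using ext(3)[of v] pos by (simp add: add_increasing2)
  next
    case False
    then have "1 / \<bar>v\<bar> * \<bar>v\<bar> = 1" by simp
    then have "\<phi> 1 \<le> 1 / \<bar>v\<bar> * \<phi> \<bar>v\<bar>"
      using convex_scale_le[OF ext(1), of "1 / \<bar>v\<bar>" "\<bar>v\<bar>"] phi False
      unfolding phi_function_def by simp
    then have "\<bar>v\<bar> \<le> 1 / \<phi> 1 * \<phi> \<bar>v\<bar>" using False pos by (simp add: field_simps)
    then show ?thesis by simp
  qed
  have "integrable ?M (\<lambda>x. c\<^sub>0 * f x)"
  proof (rule integrableI_nonneg)
    have "(\<integral>\<^sup>+x. ennreal (c\<^sub>0 * f x) \<partial>?M)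
        \<le> (\<integral>\<^sup>+x. ennreal 1 + ennreal (1 / \<phi> 1) * ennreal (\<phi> \<bar>c\<^sub>0 * f x\<bar>) \<partial>?M)"
    proof (rule nn_integral_mono)
      fix x
      have "ennreal (c\<^sub>0 * f x) \<le> ennreal (1 + 1 / \<phi> 1 * \<phi> \<bar>c\<^sub>0 * f x\<bar>)"
        using growth[of "c\<^sub>0 * f x"] by (intro ennreal_leI) simp
      also have "\<dots> = ennreal 1 + ennreal (1 / \<phi> 1 * \<phi> \<bar>c\<^sub>0 * f x\<bar>)"
        by (rule ennreal_plus) (use pos ext(3) in auto)
      also have "ennreal (1 / \<phi> 1 * \<phi> \<bar>c\<^sub>0 * f x\<bar>) = ennreal (1 / \<phi> 1) * ennreal (\<phi> \<bar>c\<^sub>0 * f x\<bar>)"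
        by (rule ennreal_mult') (use pos in simp)
      finally show "ennreal (c\<^sub>0 * f x) \<le> ennreal 1 + ennreal (1 / \<phi> 1) * ennreal (\<phi> \<bar>c\<^sub>0 * f x\<bar>)" .
    qed
    also have "\<dots> = (\<integral>\<^sup>+x. ennreal 1 \<partial>?M) + ennreal (1 / \<phi> 1) * (\<integral>\<^sup>+x. ennreal (\<phi> \<bar>c\<^sub>0 * f x\<bar>) \<partial>?M)"
    proof -
      have "(\<lambda>x. ennreal (\<phi> \<bar>c\<^sub>0 * f x\<bar>)) \<in> borel_measurable ?M"
        by (rule measurable_compose[OF _ measurable_ennreal],
            rule measurable_compose[OF _ borel_measurable_continuous_onI[OF ext(2)]]) (use f(1) in simp)
      then show ?thesis
        by (subst nn_integral_add) (simp_all add: nn_integral_cmult)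
    qed
    also have "\<dots> < \<infinity>"
      unfolding infinity_ennreal_def ennreal_add_less_top ennreal_mult_less_top
      using fin nn_integral_const_lebesgue_on_Icc[of a b 1] by simp
    finally show "(\<integral>\<^sup>+x. ennreal (c\<^sub>0 * f x) \<partial>?M) < \<infinity>" .
  qed (use f c0 in \<open>auto intro!: AE_I2\<close>)
  then show ?thesis using c0 by simp
qed

text \<open>
  Density of the continuous functions in two dominated limits: first truncate \<open>f\<close> at height \<open>N\<close>, then
  approximate the truncation almost everywhere by continuous functions and clamp these to \<open>[0,N]\<close> to
  obtain a bound. The factor \<open>2\<close> in the finiteness assumption pays for adding the two errors inside a
  convex function.
\<close>

lemma continuous_modular_approximation:
  fixes \<psi> f :: "real \<Rightarrow> real"
  assumes f: "f \<in> borel_measurable (lebesgue_on {a..b})" "\<And>x. x \<in> {a..b} \<Longrightarrow> 0 \<le> f x"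
    and \<psi>: "convex_on UNIV \<psi>" "\<psi> 0 = 0" "\<And>u. 0 \<le> \<psi> u" "\<And>u v. \<bar>u\<bar> \<le> \<bar>v\<bar> \<Longrightarrow> \<psi> u \<le> \<psi> v"
    and fin: "(\<integral>\<^sup>+x. ennreal (\<psi> (2 * f x)) \<partial>lebesgue_on {a..b}) < \<infinity>"
    and "0 < (e::real)"
  obtains g M where "continuous_on UNIV g" "\<And>x. 0 \<le> g x" "\<And>x. g x \<le> M"
    "(\<integral>\<^sup>+x. ennreal (\<psi> (f x - g x)) \<partial>lebesgue_on {a..b}) < ennreal e"
proof -
  let ?M = "lebesgue_on {a..b}"
  have cont: "continuous_on UNIV \<psi>"
    by (rule convex_on_continuous[OF open_UNIV \<psi>(1)])
  have meas: "(\<lambda>x. ennreal (\<psi> (2 * h x))) \<in> borel_measurable ?M" if "h \<in> borel_measurable ?M" for h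
  proof -
    have "(\<lambda>x. 2 * h x) \<in> borel_measurable ?M" using that by simp
    from measurable_compose[OF this borel_measurable_continuous_onI[OF cont]]
    show ?thesis by simp
  qed
  have lim0: "(\<lambda>n. ennreal (\<psi> (2 * X n))) \<longlonglongrightarrow> 0" if "X \<longlonglongrightarrow> 0" for X
  proof -
    have "(\<lambda>n. 2 * X n) \<longlonglongrightarrow> 0" by (rule tendsto_mult_right_zero[OF that])
    then have "(\<lambda>n. \<psi> (2 * X n)) \<longlonglongrightarrow> \<psi> 0"
      by (rule continuous_on_tendsto_compose[OF cont]) auto
    from tendsto_ennrealI[OF this] show ?thesis
      by (simp add: \<psi>(2))
  qed
  have "(\<lambda>N. \<integral>\<^sup>+x. ennreal (\<psi> (2 * (f x - min (f x) (real N)))) \<partial>?M) \<longlonglongrightarrow> (\<integral>\<^sup>+x. 0 \<partial>?M)"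
  proof (rule nn_integral_dominated_convergence[OF meas _ meas[OF f(1)] _ fin])
    fix N
    show "AE x in ?M. ennreal (\<psi> (2 * (f x - min (f x) (real N)))) \<le> ennreal (\<psi> (2 * f x))"
      using f(2) by (intro AE_I2 ennreal_leI \<psi>(4)) (auto simp: min_def)
  next
    show "AE x in ?M. (\<lambda>N. ennreal (\<psi> (2 * (f x - min (f x) (real N))))) \<longlonglongrightarrow> 0"
    proof (intro AE_I2 lim0)
      fix x
      obtain N0 where "f x \<le> real N0" using real_arch_simple by blast
      then have "\<forall>\<^sub>F N in sequentially. f x - min (f x) (real N) = 0"
        by (intro eventually_sequentiallyI[of N0]) auto
      then show "(\<lambda>N. f x - min (f x) (real N)) \<longlonglongrightarrow> 0"
        by (rule tendsto_eventually)
    qed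
  qed (use f(1) in auto)
  then have "\<forall>\<^sub>F N in sequentially. (\<integral>\<^sup>+x. ennreal (\<psi> (2 * (f x - min (f x) (real N)))) \<partial>?M) < ennreal (e / 2)"
    using \<open>0 < e\<close> by (intro order_tendstoD(2)) auto
  then obtain N where N: "(\<integral>\<^sup>+x. ennreal (\<psi> (2 * (f x - min (f x) (real N)))) \<partial>?M) < ennreal (e / 2)"
    using eventually_happens'[OF sequentially_bot] by blast
  define t where "t x = min (f x) (real N)" for x
  have t: "t \<in> borel_measurable ?M" using f(1) by (simp add: t_def[abs_def])
  then have "t measurable_on {a..b}"
    by (simp add: measurable_on_iff_borel_measurable)
  then obtain S G where S: "negligible S" and G: "\<And>n. continuous_on UNIV (G n)"
    "\<And>x. x \<notin> S \<Longrightarrow> (\<lambda>n. G n x) \<longlonglongrightarrow> (if x \<in> {a..b} then t x else 0)"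
    unfolding measurable_on_def by blast
  define H where "H n x = max 0 (min (real N) (G n x))" for n x
  have H: "continuous_on UNIV (H n)" for n
    unfolding H_def[abs_def] by (intro continuous_intros G)
  have Hm: "H n \<in> borel_measurable ?M" for n
    by (intro borel_measurable_lebesgue_onI borel_measurable_continuous_onI H)
  have "(\<lambda>n. \<integral>\<^sup>+x. ennreal (\<psi> (2 * (t x - H n x))) \<partial>?M) \<longlonglongrightarrow> (\<integral>\<^sup>+x. 0 \<partial>?M)"
  proof (rule nn_integral_dominated_convergence[OF meas, where w = "\<lambda>_. ennreal (\<psi> (2 * real N))"])
    fix n
    have "\<bar>2 * (t x - H n x)\<bar> \<le> \<bar>2 * real N\<bar>" if "x \<in> {a..b}" for x
      using f(2)[OF that] by (auto simp: t_def H_def)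
    then show "AE x in ?M. ennreal (\<psi> (2 * (t x - H n x))) \<le> ennreal (\<psi> (2 * real N))"
      by (intro AE_I2 ennreal_leI \<psi>(4)) simp
  next
    have "AE x in lebesgue. x \<notin> S"
      by (rule AE_not_in) (use S in \<open>simp add: negligible_iff_null_sets\<close>)
    then have "AE x in ?M. x \<notin> S \<and> x \<in> {a..b}"
      by (subst AE_restrict_space_iff) auto
    then show "AE x in ?M. (\<lambda>n. ennreal (\<psi> (2 * (t x - H n x)))) \<longlonglongrightarrow> 0"
    proof eventually_elim
      case (elim x)
      then have "(\<lambda>n. G n x) \<longlonglongrightarrow> t x" using G(2)[of x] by simp
      then have "(\<lambda>n. t x - H n x) \<longlonglongrightarrow> t x - max 0 (min (real N) (t x))"
        unfolding H_def by (intro tendsto_intros)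
      moreover have "max 0 (min (real N) (t x)) = t x"
        using f(2)[of x] elim by (auto simp: t_def)
      ultimately show ?case by (intro lim0) simp
    qed
  next
    show "(\<lambda>x. t x - H n x) \<in> borel_measurable ?M" for n
      using t Hm by simp
  qed (simp, simp, rule nn_integral_const_lebesgue_on_Icc)
  then have "\<forall>\<^sub>F n in sequentially. (\<integral>\<^sup>+x. ennreal (\<psi> (2 * (t x - H n x))) \<partial>?M) < ennreal (e / 2)"
    using \<open>0 < e\<close> by (intro order_tendstoD(2)) auto
  then obtain n where n: "(\<integral>\<^sup>+x. ennreal (\<psi> (2 * (t x - H n x))) \<partial>?M) < ennreal (e / 2)"
    using eventually_happens'[OF sequentially_bot] by blast
  have "\<psi> (f x - H n x) \<le> \<psi> (2 * (f x - t x)) + \<psi> (2 * (t x - H n x))" for x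
  proof -
    have "f x - H n x = (1 - 1/2) *\<^sub>R (2 * (f x - t x)) + (1/2) *\<^sub>R (2 * (t x - H n x))"
      by (simp add: field_simps)
    also have "\<psi> \<dots> \<le> (1 - 1/2) * \<psi> (2 * (f x - t x)) + 1/2 * \<psi> (2 * (t x - H n x))"
      by (rule convex_onD[OF \<psi>(1)]) auto
    finally show ?thesis
      using \<psi>(3)[of "2 * (f x - t x)"] \<psi>(3)[of "2 * (t x - H n x)"] by simp
  qed
  then have "ennreal (\<psi> (f x - H n x)) \<le> ennreal (\<psi> (2 * (f x - t x))) + ennreal (\<psi> (2 * (t x - H n x)))" for x
    by (subst ennreal_plus[symmetric]) (auto intro: ennreal_leI \<psi>(3))
  then have "(\<integral>\<^sup>+x. ennreal (\<psi> (f x - H n x)) \<partial>?M)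
      \<le> (\<integral>\<^sup>+x. ennreal (\<psi> (2 * (f x - t x))) + ennreal (\<psi> (2 * (t x - H n x))) \<partial>?M)"
    by (rule nn_integral_mono)
  also have "\<dots> = (\<integral>\<^sup>+x. ennreal (\<psi> (2 * (f x - t x))) \<partial>?M) + (\<integral>\<^sup>+x. ennreal (\<psi> (2 * (t x - H n x))) \<partial>?M)"
    by (rule nn_integral_add; rule meas) (use f(1) t Hm in auto)
  also have "\<dots> < ennreal (e / 2) + ennreal (e / 2)"
    by (rule add_strict_mono) (use N n in \<open>auto simp: t_def\<close>)
  also have "\<dots> = ennreal e"
    using \<open>0 < e\<close> by (subst ennreal_plus[symmetric]) auto
  finally show ?thesis
    by (intro that[of "H n" "real N"] H) (auto simp: H_def)
qed

section \<open>The kernel of a sigmoidal function\<close>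

locale sigmoidal_kernel =
  fixes \<sigma> :: "real \<Rightarrow> real"
  assumes mono_\<sigma>: "mono \<sigma>" and sigmoidal: "sigmoidal \<sigma>"
    and Sigma1: "Sigma1 \<sigma>" and Sigma2: "Sigma2 \<sigma>"
begin

lemma \<sigma>_minus: "\<sigma> (- x) = 1 - \<sigma> x"
  using Sigma1 unfolding Sigma1_def by (auto simp: algebra_simps dest: spec[of _ x])

lemma \<sigma>_bounds: "0 \<le> \<sigma> x" "\<sigma> x \<le> 1"
proof -
  have lim: "(\<sigma> \<longlongrightarrow> 0) at_bot" "(\<sigma> \<longlongrightarrow> 1) at_top"
    using sigmoidal by (auto simp: sigmoidal_def)
  show "0 \<le> \<sigma> x"
    by (rule tendsto_upperbound[OF lim(1)])
      (auto intro: eventually_mono[OF eventually_le_at_bot[of x]] monoD[OF mono_\<sigma>])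
  show "\<sigma> x \<le> 1"
    by (rule tendsto_lowerbound[OF lim(2)])
      (auto intro: eventually_mono[OF eventually_ge_at_top[of x]] monoD[OF mono_\<sigma>])
qed

lemma kernel_nonneg: "0 \<le> phi_sigma \<sigma> x"
  using monoD[OF mono_\<sigma>, of "x - 1" "x + 1"] by (simp add: phi_sigma_def)

lemma kernel_even: "phi_sigma \<sigma> (- x) = phi_sigma \<sigma> x"
proof -
  have "\<sigma> (- x + 1) = 1 - \<sigma> (x - 1)" "\<sigma> (- x - 1) = 1 - \<sigma> (x + 1)"
    using \<sigma>_minus[of "x - 1"] \<sigma>_minus[of "x + 1"] by simp_all
  then show ?thesis by (simp add: phi_sigma_def)
qed

text \<open>
  By evenness, monotonicity on the positive half-line becomes monotonicity in the absolute value.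
\<close>

lemma kernel_antimono: "\<bar>x\<bar> \<le> \<bar>y\<bar> \<Longrightarrow> phi_sigma \<sigma> y \<le> phi_sigma \<sigma> x"
proof -
  assume "\<bar>x\<bar> \<le> \<bar>y\<bar>"
  moreover have "antimono_on {0..} (phi_sigma \<sigma>)"
    using Sigma2 by (simp add: Sigma2_def)
  ultimately have "phi_sigma \<sigma> \<bar>y\<bar> \<le> phi_sigma \<sigma> \<bar>x\<bar>"
    by (auto simp: monotone_on_def)
  moreover have "phi_sigma \<sigma> \<bar>z\<bar> = phi_sigma \<sigma> z" for z
    by (cases "0 \<le> z") (simp_all add: kernel_even)
  ultimately show ?thesis by simp
qed

lemma kernel_tendsto_0: "(phi_sigma \<sigma> \<longlongrightarrow> 0) at_top"
proof -
  have lim: "(\<sigma> \<longlongrightarrow> 1) at_top"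
    using sigmoidal by (auto simp: sigmoidal_def)
  have "((\<lambda>x. \<sigma> (x + 1)) \<longlongrightarrow> 1) at_top" "((\<lambda>x. \<sigma> (x - 1)) \<longlongrightarrow> 1) at_top"
    using filterlim_compose[OF lim filterlim_tendsto_add_at_top[OF tendsto_const filterlim_ident, of 1]]
      filterlim_compose[OF lim filterlim_tendsto_add_at_top[OF tendsto_const filterlim_ident, of "-1"]]
    by (simp_all add: add.commute)
  then have "((\<lambda>x. (\<sigma> (x + 1) - \<sigma> (x - 1)) / 2) \<longlongrightarrow> (1 - 1) / 2) at_top"
    by (intro tendsto_intros) auto
  then show ?thesis
    by (simp add: phi_sigma_def[abs_def])
qed

text \<open>
  If the kernel vanished at \<open>1\<close> it would vanish on \<open>[1,\<infinity>)\<close>, so \<open>\<sigma>\<close> would have period \<open>2\<close> on the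
  non-negative half-line; but \<open>\<sigma> 0 = 1/2\<close> by symmetry, while \<open>\<sigma>\<close> tends to \<open>1\<close>. Positivity at \<open>1\<close> is
  what bounds the denominator from below: outside a short strip at \<open>b\<close>, every \<open>n x\<close> is at distance at
  most \<open>1\<close> from some index.
\<close>

lemma kernel_1_pos: "0 < phi_sigma \<sigma> 1"
proof (rule ccontr)
  assume "\<not> 0 < phi_sigma \<sigma> 1"
  then have zero: "phi_sigma \<sigma> 1 = 0"
    using kernel_nonneg[of 1] by simp
  have step: "\<sigma> (x + 1) = \<sigma> (x - 1)" if "1 \<le> x" for x
  proof -
    have "phi_sigma \<sigma> x = 0"
      using kernel_antimono[of 1 x] kernel_nonneg[of x] zero that by simp
    then show ?thesis by (simp add: phi_sigma_def)
  qed
  have half: "\<sigma> (2 * real m) = 1 / 2" for m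
  proof (induction m)
    case 0
    then show ?case using \<sigma>_minus[of 0] by simp
  next
    case (Suc m)
    then show ?case using step[of "2 * real m + 1"] by (simp add: algebra_simps)
  qed
  have "(\<sigma> \<longlongrightarrow> 1) at_top"
    using sigmoidal by (auto simp: sigmoidal_def)
  then have "(\<lambda>m. \<sigma> (2 * real m)) \<longlonglongrightarrow> 1"
    by (rule filterlim_compose)
      (intro filterlim_tendsto_pos_mult_at_top[OF tendsto_const] filterlim_real_sequentially, simp)
  then show False
    using half LIMSEQ_unique[OF _ tendsto_const, of "1/2 :: real" 1] by simp
qed

lemma kernel_measurable [measurable]: "phi_sigma \<sigma> \<in> borel_measurable borel"
  using borel_measurable_mono[OF mono_\<sigma>] unfolding phi_sigma_def[abs_def] by measurable

text \<open>
  The integral telescopes to \<open>(\<integral>\<^bsub>q-1\<^esub>\<^bsup>q+1\<^esup> \<sigma> - \<integral>\<^bsub>p-1\<^esub>\<^bsup>p+1\<^esup> \<sigma>) / 2\<close>, and \<open>\<sigma>\<close> takes values in \<open>[0,1]\<close>. The bound does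
  not depend on the interval.
\<close>

lemma kernel_integral_le:
  assumes "p \<le> q"
  shows "phi_sigma \<sigma> integrable_on {p..q}" and "integral {p..q} (phi_sigma \<sigma>) \<le> 1"
proof -
  have int: "\<sigma> integrable_on {u..v}" for u v
    using integrable_on_mono_on[of u v \<sigma>] mono_\<sigma> by (auto simp: mono_on_def mono_def)
  have shift: "((\<lambda>x. \<sigma> (x + c)) has_integral integral {p + c..q + c} \<sigma>) {p..q}" for c
    using has_integral_shift_Icc_real[of \<sigma> c "integral {p + c..q + c} \<sigma>" p q] int
    by (simp add: o_def add.commute integrable_integral)
  have "(phi_sigma \<sigma> has_integral (integral {p+1..q+1} \<sigma> - integral {p-1..q-1} \<sigma>) / 2) {p..q}"
    using has_integral_divide[OF has_integral_diff[OF shift[of 1] shift[of "-1"]], of 2]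
    by (simp add: phi_sigma_def[abs_def])
  moreover have "integral {p+1..q+1} \<sigma> - integral {p-1..q-1} \<sigma> \<le> 2"
  proof -
    have "integral {p-1..q-1} \<sigma> + integral {q-1..q+1} \<sigma> = integral {p-1..q+1} \<sigma>"
      by (rule Henstock_Kurzweil_Integration.integral_combine) (use assms int in auto)
    moreover have "integral {p-1..p+1} \<sigma> + integral {p+1..q+1} \<sigma> = integral {p-1..q+1} \<sigma>"
      by (rule Henstock_Kurzweil_Integration.integral_combine) (use assms int in auto)
    moreover have "integral {q-1..q+1} \<sigma> \<le> integral {q-1..q+1} (\<lambda>x. 1)"
      by (rule integral_le) (use int \<sigma>_bounds in auto)
    moreover have "0 \<le> integral {p-1..p+1} \<sigma>"
      by (rule integral_nonneg) (use int \<sigma>_bounds in auto)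
    ultimately show ?thesis by simp
  qed
  ultimately show "phi_sigma \<sigma> integrable_on {p..q}" "integral {p..q} (phi_sigma \<sigma>) \<le> 1"
    by (auto simp: has_integral_iff)
qed

lemma kernel_nn_integral_le:
  assumes "p \<le> q" and "0 < m"
  shows "(\<integral>\<^sup>+x\<in>{p..q}. ennreal (phi_sigma \<sigma> (m * x - t)) \<partial>lebesgue) \<le> ennreal (1 / m)"
proof -
  define I where "I = integral {m * p - t..m * q - t} (phi_sigma \<sigma>)"
  have pq: "m * p - t \<le> m * q - t" using assms by simp
  have "(phi_sigma \<sigma> has_integral I) (cbox (m * p - t) (m * q - t))"
    using kernel_integral_le(1)[OF pq] by (simp add: I_def integrable_integral)
  from has_integral_affinity'[OF this \<open>0 < m\<close>, of "- t"]
  have "((\<lambda>x. phi_sigma \<sigma> (m * x - t)) has_integral I / m) {p..q}"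
    using assms by (simp add: field_simps)
  then have "(\<integral>\<^sup>+x. ennreal (phi_sigma \<sigma> (m * x - t)) * indicator {p..q} x \<partial>lborel) = ennreal (I / m)"
    by (rule nn_integral_has_integral_lebesgue'[rotated]) (rule kernel_nonneg)
  moreover have "I / m \<le> 1 / m"
    using kernel_integral_le(2)[OF pq] \<open>0 < m\<close> by (simp add: I_def divide_right_mono)
  ultimately show ?thesis
    by (simp add: nn_integral_completion ennreal_leI)
qed

end

section \<open>The operator as a maximum of weighted cell means\<close>

definition cell :: "nat \<Rightarrow> int \<Rightarrow> real set" where
  "cell n k = {of_int k / real n..(of_int k + 1) / real n}"

definition cell_mean :: "(real \<Rightarrow> real) \<Rightarrow> nat \<Rightarrow> int \<Rightarrow> real" where
  "cell_mean h n k = real n * (LINT u:cell n k|lebesgue. h u)"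

text \<open>
  The kernel normalized by its maximum over the index set. Where that maximum is \<open>0\<close> every weight is
  \<open>0\<close>, in agreement with the value of the operator there.
\<close>

definition weight :: "(real \<Rightarrow> real) \<Rightarrow> real \<Rightarrow> real \<Rightarrow> nat \<Rightarrow> int \<Rightarrow> real \<Rightarrow> real" where
  "weight \<sigma> a b n k x =
     phi_sigma \<sigma> (real n * x - of_int k) / (MAX j\<in>index_set a b n. phi_sigma \<sigma> (real n * x - of_int j))"

lemma finite_index_set [simp]: "finite (index_set a b n)"
  by (simp add: index_set_def)

lemma index_set_iff: "k \<in> index_set a b n \<longleftrightarrow> real n * a \<le> of_int k \<and> of_int k + 1 \<le> real n * b"
  unfolding index_set_def atLeastAtMost_iff ceiling_le_iff by linarith

lemma cell_subset: "0 < n \<Longrightarrow> k \<in> index_set a b n \<Longrightarrow> cell n k \<subseteq> {a..b}"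
  by (auto simp: cell_def index_set_iff field_simps intro: order_trans)

text \<open>
  The form in which Jensen's inequality applies: the length of a cell is computed from its end points.
\<close>

lemma cell_mean_eq_average:
  "cell_mean h n k = (LINT u:cell n k|lebesgue. h u)
     / ((of_int k + 1) / real n - of_int k / real n)"
  by (simp add: cell_mean_def cell_def diff_divide_distrib[symmetric])

text \<open>
  The cells are closed, so a common end point belongs to two of them. Counting each point twice is harmless
  in the estimates and avoids discarding null sets.
\<close>

lemma cells_overlap_le_2:
  assumes "0 < n" "finite J"
  shows "(\<Sum>k\<in>J. indicator (cell n k) x :: ennreal) \<le> 2"
proof -
  have "k \<in> {\<lfloor>real n * x\<rfloor>, \<lceil>real n * x\<rceil> - 1}" if "x \<in> cell n k" for k
  proof -
    have "of_int k \<le> real n * x" "real n * x \<le> of_int k + 1"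
      using that \<open>0 < n\<close> by (auto simp: cell_def field_simps)
    then show ?thesis by (simp, linarith)
  qed
  then have "card {k\<in>J. x \<in> cell n k} \<le> card {\<lfloor>real n * x\<rfloor>, \<lceil>real n * x\<rceil> - 1}"
    by (intro card_mono) auto
  also have "\<dots> \<le> 2" by (simp add: card_insert_if)
  finally have "(of_nat (card {k\<in>J. x \<in> cell n k}) :: ennreal) \<le> of_nat 2"
    by (simp only: of_nat_le_iff)
  moreover have "(\<Sum>k\<in>J. indicator (cell n k) x :: ennreal) = of_nat (card {k\<in>J. x \<in> cell n k})"
    using \<open>finite J\<close> by (simp add: indicator_def sum.If_cases Int_def)
  ultimately show ?thesis by simp
qed

lemma cell_mean_bounds:
  assumes "0 < n" "set_integrable lebesgue (cell n k) h"
    and "\<And>u. u \<in> cell n k \<Longrightarrow> l \<le> h u" "\<And>u. u \<in> cell n k \<Longrightarrow> h u \<le> r"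
  shows "l \<le> cell_mean h n k" "cell_mean h n k \<le> r"
proof -
  have const: "set_integrable lebesgue (cell n k) (\<lambda>u. c)" for c :: real
    using \<open>0 < n\<close> by (auto simp: set_integrable_def cell_def emeasure_lborel_Icc divide_right_mono)
  have mean: "cell_mean (\<lambda>_. c) n k = c" for c
    using \<open>0 < n\<close>
    by (simp add: cell_mean_def cell_def set_lebesgue_integral_def divide_right_mono diff_divide_distrib[symmetric])
  have "(LINT u:cell n k|lebesgue. l) \<le> (LINT u:cell n k|lebesgue. h u)"
    by (rule set_integral_mono) (use assms const in auto)
  then have "cell_mean (\<lambda>_. l) n k \<le> cell_mean h n k"
    unfolding cell_mean_def by (rule mult_left_mono) simp
  then show "l \<le> cell_mean h n k"
    by (simp only: mean)
  have "(LINT u:cell n k|lebesgue. h u) \<le> (LINT u:cell n k|lebesgue. r)"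
    by (rule set_integral_mono) (use assms const in auto)
  then have "cell_mean h n k \<le> cell_mean (\<lambda>_. r) n k"
    unfolding cell_mean_def by (rule mult_left_mono) simp
  then show "cell_mean h n k \<le> r"
    by (simp only: mean)
qed

lemma cell_mean_le_add:
  assumes "set_integrable lebesgue (cell n k) f" "set_integrable lebesgue (cell n k) g"
    "set_integrable lebesgue (cell n k) h" "\<And>u. u \<in> cell n k \<Longrightarrow> f u \<le> g u + h u"
  shows "cell_mean f n k \<le> cell_mean g n k + cell_mean h n k"
proof -
  have "(LINT u:cell n k|lebesgue. f u) \<le> (LINT u:cell n k|lebesgue. g u + h u)"
    by (rule set_integral_mono) (use assms in \<open>auto intro: set_integral_add(1)\<close>)
  also have "\<dots> = (LINT u:cell n k|lebesgue. g u) + (LINT u:cell n k|lebesgue. h u)"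
    by (rule set_integral_add(2)) (use assms in auto)
  finally show ?thesis
    unfolding cell_mean_def by (simp add: mult_left_mono flip: distrib_left)
qed

lemma set_integrable_cell:
  fixes h :: "real \<Rightarrow> real"
  assumes "integrable (lebesgue_on {a..b}) h" "0 < n" "k \<in> index_set a b n"
  shows "set_integrable lebesgue (cell n k) h"
proof (rule set_integrable_subset)
  show "set_integrable lebesgue {a..b} h"
    using assms(1) unfolding set_integrable_def by (subst (asm) integrable_restrict_space) auto
qed (use cell_subset[OF assms(2,3)] in \<open>auto simp: cell_def\<close>)

context sigmoidal_kernel
begin

lemma kernel_max_nonneg:
  "index_set a b n \<noteq> {} \<Longrightarrow> 0 \<le> (MAX j\<in>index_set a b n. phi_sigma \<sigma> (real n * x - of_int j))"
  by (subst Max_ge_iff) (auto simp: kernel_nonneg)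

lemma weight_nonneg: "k \<in> index_set a b n \<Longrightarrow> 0 \<le> weight \<sigma> a b n k x"
  unfolding weight_def by (intro divide_nonneg_nonneg kernel_nonneg kernel_max_nonneg) auto

lemma weight_le_1:
  assumes "k \<in> index_set a b n"
  shows "weight \<sigma> a b n k x \<le> 1"
proof -
  let ?D = "MAX j\<in>index_set a b n. phi_sigma \<sigma> (real n * x - of_int j)"
  have "phi_sigma \<sigma> (real n * x - of_int k) \<le> ?D" and "0 \<le> ?D"
    using assms by (auto intro: Max_ge kernel_max_nonneg)
  then show ?thesis by (auto simp: weight_def divide_le_eq_1)
qed

text \<open>
  For \<open>n x < \<lfloor>n b\<rfloor>\<close> the index \<open>\<lfloor>n x\<rfloor>\<close>, or \<open>\<lceil>n a\<rceil>\<close> when \<open>x\<close> lies left of the first cell, is admissible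
  and at distance at most \<open>1\<close> from \<open>n x\<close>. Only right of \<open>\<lfloor>n b\<rfloor> / n\<close> can this fail.
\<close>

lemma kernel_max_ge:
  assumes "0 < n" "index_set a b n \<noteq> {}" "a \<le> x" "real n * x < of_int \<lfloor>real n * b\<rfloor>"
  shows "phi_sigma \<sigma> 1 \<le> (MAX j\<in>index_set a b n. phi_sigma \<sigma> (real n * x - of_int j))"
proof -
  have na: "real n * a \<le> real n * x" using assms by simp
  define k where "k = max \<lfloor>real n * x\<rfloor> \<lceil>real n * a\<rceil>"
  have "\<lfloor>real n * x\<rfloor> < \<lfloor>real n * b\<rfloor>" 
    using assms(4) by linarith
  with \<open>index_set a b n \<noteq> {}\<close> have "k \<in> index_set a b n"
    by (auto simp: index_set_def k_def)
  moreover have "\<bar>real n * x - of_int k\<bar> \<le> \<bar>1\<bar>"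
    using na unfolding k_def by (simp add: max_def) linarith
  ultimately show ?thesis
    by (subst Max_ge_iff) (auto intro!: bexI[of _ k] kernel_antimono)
qed

lemma weight_le_kernel:
  assumes "0 < n" "k \<in> index_set a b n" "a \<le> x" "real n * x < of_int \<lfloor>real n * b\<rfloor>"
  shows "weight \<sigma> a b n k x \<le> phi_sigma \<sigma> (real n * x - of_int k) / phi_sigma \<sigma> 1"
  unfolding weight_def
  by (intro divide_left_mono kernel_max_ge kernel_nonneg mult_pos_pos kernel_1_pos
        less_le_trans[OF kernel_1_pos kernel_max_ge]) (use assms in auto)

lemma weight_measurable [measurable]: "weight \<sigma> a b n k \<in> borel_measurable borel"
  unfolding weight_def[abs_def] by measurable

text \<open>
  Dividing by a non-negative number is monotone, also under the convention \<open>y / 0 = 0\<close>, so it commutes with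
  the maximum and no case distinction on the denominator is needed.
\<close>

lemma kantorovich_eq_Max:
  assumes "index_set a b n \<noteq> {}"
  shows "max_product_kantorovich \<sigma> a b n h x
    = (MAX k\<in>index_set a b n. cell_mean h n k * weight \<sigma> a b n k x)"
proof -
  let ?J = "index_set a b n"
  let ?D = "MAX j\<in>?J. phi_sigma \<sigma> (real n * x - of_int j)"
  have "max_product_kantorovich \<sigma> a b n h x
    = (MAX k\<in>?J. cell_mean h n k * phi_sigma \<sigma> (real n * x - of_int k)) / ?D"
    unfolding max_product_kantorovich_def cell_mean_def cell_def
    by (subst (1 2) cSup_eq_Max) (use assms in auto)
  also have "\<dots> = Max ((\<lambda>y. y / ?D) ` (\<lambda>k. cell_mean h n k * phi_sigma \<sigma> (real n * x - of_int k)) ` ?J)"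
    by (rule mono_Max_commute) (use assms kernel_max_nonneg[OF assms] in \<open>auto intro!: monoI divide_right_mono\<close>)
  finally show ?thesis
    by (simp add: image_image weight_def)
qed

lemma kantorovich_measurable:
  assumes "index_set a b n \<noteq> {}"
  shows "max_product_kantorovich \<sigma> a b n h \<in> borel_measurable borel"
  unfolding kantorovich_eq_Max[OF assms, abs_def] by (intro borel_measurable_Max) auto

lemma kantorovich_bounds:
  assumes J: "index_set a b n \<noteq> {}"
    and means: "\<And>k. k \<in> index_set a b n \<Longrightarrow> 0 \<le> cell_mean h n k"
               "\<And>k. k \<in> index_set a b n \<Longrightarrow> cell_mean h n k \<le> M"
  shows "0 \<le> max_product_kantorovich \<sigma> a b n h x" "max_product_kantorovich \<sigma> a b n h x \<le> M"
proof -
  obtain k where k: "k \<in> index_set a b n" using J by auto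
  show "0 \<le> max_product_kantorovich \<sigma> a b n h x"
    unfolding kantorovich_eq_Max[OF J]
    by (subst Max_ge_iff) (use J k means weight_nonneg in \<open>auto intro!: bexI[of _ k]\<close>)
  show "max_product_kantorovich \<sigma> a b n h x \<le> M"
    unfolding kantorovich_eq_Max[OF J]
  proof (subst Max_le_iff, simp_all add: J, intro ballI)
    fix j assume j: "j \<in> index_set a b n"
    have "cell_mean h n j * weight \<sigma> a b n j x \<le> cell_mean h n j * 1"
      using means(1)[OF j] weight_le_1[OF j] by (intro mult_left_mono) auto
    then show "cell_mean h n j * weight \<sigma> a b n j x \<le> M"
      using means(2)[OF j] by simp
  qed
qed

text \<open>
  Subadditivity of the maximum. Used with \<open>h = \<bar>f - g\<bar>\<close> in both directions, it replaces linearity.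
\<close>

lemma kantorovich_le_add:
  assumes J: "index_set a b n \<noteq> {}"
    and means: "\<And>k. k \<in> index_set a b n \<Longrightarrow> cell_mean f n k \<le> cell_mean g n k + cell_mean h n k"
  shows "max_product_kantorovich \<sigma> a b n f x
           \<le> max_product_kantorovich \<sigma> a b n g x + max_product_kantorovich \<sigma> a b n h x"
  unfolding kantorovich_eq_Max[OF J]
proof (subst Max_le_iff, simp_all add: J, intro ballI)
  fix k assume k: "k \<in> index_set a b n"
  have "cell_mean f n k * weight \<sigma> a b n k x
      \<le> cell_mean g n k * weight \<sigma> a b n k x + cell_mean h n k * weight \<sigma> a b n k x"
    using mult_right_mono[OF means[OF k] weight_nonneg[OF k]] by (simp add: distrib_right)
  also have "\<dots> \<le> (MAX k\<in>index_set a b n. cell_mean g n k * weight \<sigma> a b n k x)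
      + (MAX k\<in>index_set a b n. cell_mean h n k * weight \<sigma> a b n k x)"
    using k by (intro add_mono Max_ge) auto
  finally show "cell_mean f n k * weight \<sigma> a b n k x \<le> \<dots>" .
qed

text \<open>
  Left of \<open>\<lfloor>n b\<rfloor> / n\<close> the weight is at most the kernel divided by its value at \<open>1\<close>, whose integral is
  controlled by scaling. On the remaining strip, of length at most \<open>1/n\<close>, the trivial bound \<open>1\<close> is enough.
\<close>

lemma weight_nn_integral_le:
  assumes n: "0 < n" and k: "k \<in> index_set a b n"
  shows "(\<integral>\<^sup>+x\<in>{a..b}. ennreal (weight \<sigma> a b n k x) \<partial>lebesgue)
           \<le> ennreal ((1 / phi_sigma \<sigma> 1 + 1) / real n)"
proof -
  let ?c = "of_int \<lfloor>real n * b\<rfloor> / real n"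
  have ab: "a \<le> b" 
  proof -
    have "real n * a \<le> real n * b" using k by (auto simp: index_set_iff)
    then show ?thesis using n by simp
  qed
  have c: "?c \<le> b" "b \<le> ?c + 1 / real n"
    using n by (auto simp: field_simps) linarith
  have "(\<integral>\<^sup>+x\<in>{a..b}. ennreal (weight \<sigma> a b n k x) \<partial>lebesgue)
      \<le> (\<integral>\<^sup>+x. ennreal (1 / phi_sigma \<sigma> 1) * (ennreal (phi_sigma \<sigma> (real n * x - of_int k)) * indicator {a..b} x)
            + indicator {?c..b} x \<partial>lebesgue)"
  proof (rule nn_integral_mono)
    fix x
    show "ennreal (weight \<sigma> a b n k x) * indicator {a..b} x
      \<le> ennreal (1 / phi_sigma \<sigma> 1) * (ennreal (phi_sigma \<sigma> (real n * x - of_int k)) * indicator {a..b} x)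
            + indicator {?c..b} x"
    proof (cases "x \<in> {a..b}")
      case x: True
      show ?thesis
      proof (cases "real n * x < of_int \<lfloor>real n * b\<rfloor>")
        case True
        have "ennreal (weight \<sigma> a b n k x) \<le> ennreal (1 / phi_sigma \<sigma> 1 * phi_sigma \<sigma> (real n * x - of_int k))"
          using weight_le_kernel[OF n k _ True] x by (intro ennreal_leI) simp
        also have "\<dots> = ennreal (1 / phi_sigma \<sigma> 1) * ennreal (phi_sigma \<sigma> (real n * x - of_int k))"
          using kernel_1_pos by (intro ennreal_mult') simp
        finally show ?thesis using x by (simp add: add_increasing2)
      next
        case False
        then have "x \<in> {?c..b}" using x n by (simp add: field_simps)
        moreover have "ennreal (weight \<sigma> a b n k x) \<le> 1"
          using weight_le_1[OF k] by (simp add: ennreal_le_1)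
        ultimately show ?thesis using x by (simp add: add_increasing)
      qed
    qed simp
  qed
  also have "\<dots> = ennreal (1 / phi_sigma \<sigma> 1)
        * (\<integral>\<^sup>+x\<in>{a..b}. ennreal (phi_sigma \<sigma> (real n * x - of_int k)) \<partial>lebesgue)
      + emeasure lebesgue {?c..b}"
    by (simp add: nn_integral_add nn_integral_cmult nn_integral_completion)
  also have "\<dots> \<le> ennreal (1 / phi_sigma \<sigma> 1) * ennreal (1 / real n) + ennreal (1 / real n)"
    using c by (intro add_mono mult_left_mono kernel_nn_integral_le ab) (use n in \<open>auto intro!: ennreal_leI\<close>)
  also have "\<dots> = ennreal ((1 / phi_sigma \<sigma> 1 + 1) / real n)"
    using kernel_1_pos by (simp add: ennreal_mult'[symmetric] add_divide_distrib flip: ennreal_plus)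
  finally show ?thesis .
qed

end

section \<open>Modular boundedness of the operators\<close>

context sigmoidal_kernel
begin

text \<open>
  The uniform modular inequality. The maximum is attained at some index \<open>k\<close>; convexity moves the weight
  out of \<open>\<psi>\<close>, and enlarging the single term to the sum over all indices makes the bound integrable term
  by term. The factor \<open>1/n\<close> from the weights cancels the factor \<open>n\<close> in the cell means, and the factor
  \<open>2\<close> comes from the overlap of the closed cells.
\<close>

lemma kantorovich_modular_le:
  fixes \<psi> :: "real \<Rightarrow> real"
  assumes conv: "convex_on UNIV \<psi>" and zero: "\<psi> 0 = 0" and nonneg: "\<And>u. 0 \<le> \<psi> u"
    and h: "integrable (lebesgue_on {a..b}) h"
    and n: "0 < n" and J: "index_set a b n \<noteq> {}"
  shows "(\<integral>\<^sup>+x. ennreal (\<psi> (max_product_kantorovich \<sigma> a b n h x)) \<partial>lebesgue_on {a..b})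
           \<le> ennreal (2 * (1 / phi_sigma \<sigma> 1 + 1)) * (\<integral>\<^sup>+x. ennreal (\<psi> (h x)) \<partial>lebesgue_on {a..b})"
proof -
  let ?J = "index_set a b n"
  define B where "B = 1 / phi_sigma \<sigma> 1 + 1"
  have cont: "continuous_on UNIV \<psi>"
    by (rule convex_on_continuous[OF open_UNIV conv])
  have B: "0 < B" using kernel_1_pos by (simp add: B_def add_pos_pos)
  have psih: "(\<lambda>x. \<psi> (h x)) \<in> borel_measurable (lebesgue_on {a..b})"
    using measurable_compose[OF borel_measurable_integrable[OF h] borel_measurable_continuous_onI[OF cont]] .
  have cells: "ennreal (\<psi> (cell_mean h n k))
      \<le> ennreal (real n) * (\<integral>\<^sup>+x. ennreal (\<psi> (h x)) * indicator (cell n k) x \<partial>lebesgue_on {a..b})"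
    if k: "k \<in> ?J" for k
  proof -
    have less: "of_int k / real n < (of_int k + 1) / real n" using n by (simp add: divide_strict_right_mono)
    have width: "1 / ((of_int k + 1) / real n - of_int k / real n) = real n"
      by (simp add: diff_divide_distrib[symmetric])
    have "ennreal (\<psi> (cell_mean h n k))
        \<le> ennreal (real n) * (\<integral>\<^sup>+x\<in>cell n k. ennreal (\<psi> (h x)) \<partial>lebesgue)"
      using jensen_interval[OF conv nonneg set_integrable_cell[OF h n k, unfolded cell_def] less]
      unfolding cell_def[symmetric] cell_mean_eq_average[symmetric] width .
    also have "(\<integral>\<^sup>+x\<in>cell n k. ennreal (\<psi> (h x)) \<partial>lebesgue)
        = (\<integral>\<^sup>+x. ennreal (\<psi> (h x)) * indicator (cell n k) x \<partial>lebesgue_on {a..b})"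
      using cell_subset[OF n k]
      by (subst nn_integral_restrict_space) (simp, auto intro!: nn_integral_cong simp: indicator_def)
    finally show ?thesis .
  qed
  have "ennreal (\<psi> (max_product_kantorovich \<sigma> a b n h x))
      \<le> (\<Sum>k\<in>?J. ennreal (\<psi> (cell_mean h n k)) * ennreal (weight \<sigma> a b n k x))" for x
  proof -
    have "(MAX k\<in>?J. cell_mean h n k * weight \<sigma> a b n k x)
        \<in> (\<lambda>k. cell_mean h n k * weight \<sigma> a b n k x) ` ?J"
      by (rule Max_in) (use J in auto)
    then obtain k where k: "k \<in> ?J"
      and K: "max_product_kantorovich \<sigma> a b n h x = weight \<sigma> a b n k x * cell_mean h n k"
      by (auto simp: kantorovich_eq_Max[OF J] mult.commute)
    have "\<psi> (max_product_kantorovich \<sigma> a b n h x) \<le> weight \<sigma> a b n k x * \<psi> (cell_mean h n k)"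
      unfolding K by (rule convex_scale_le[OF conv zero weight_nonneg[OF k] weight_le_1[OF k]])
    then have "ennreal (\<psi> (max_product_kantorovich \<sigma> a b n h x))
        \<le> ennreal (\<psi> (cell_mean h n k)) * ennreal (weight \<sigma> a b n k x)"
      by (subst ennreal_mult'[symmetric]) (auto simp: nonneg mult.commute[of _ "weight _ _ _ _ _ _"] intro!: ennreal_leI)
    also have "\<dots> \<le> (\<Sum>k\<in>?J. ennreal (\<psi> (cell_mean h n k)) * ennreal (weight \<sigma> a b n k x))"
      by (rule member_le_sum) (use k in auto)
    finally show ?thesis .
  qed
  then have "(\<integral>\<^sup>+x. ennreal (\<psi> (max_product_kantorovich \<sigma> a b n h x)) \<partial>lebesgue_on {a..b})
      \<le> (\<integral>\<^sup>+x. (\<Sum>k\<in>?J. ennreal (\<psi> (cell_mean h n k)) * ennreal (weight \<sigma> a b n k x)) \<partial>lebesgue_on {a..b})"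
    by (intro nn_integral_mono)
  also have "\<dots> = (\<Sum>k\<in>?J. ennreal (\<psi> (cell_mean h n k)) * (\<integral>\<^sup>+x. ennreal (weight \<sigma> a b n k x) \<partial>lebesgue_on {a..b}))"
  proof -
    have [measurable]: "weight \<sigma> a b n k \<in> borel_measurable (lebesgue_on {a..b})" for k
      by (intro borel_measurable_lebesgue_onI) simp
    show ?thesis by (simp add: nn_integral_sum nn_integral_cmult)
  qed
  also have "\<dots> \<le> (\<Sum>k\<in>?J. (ennreal (real n) * (\<integral>\<^sup>+x. ennreal (\<psi> (h x)) * indicator (cell n k) x \<partial>lebesgue_on {a..b}))
      * ennreal (B / real n))"
  proof (intro sum_mono mult_mono cells)
    fix k assume "k \<in> ?J"
    then show "(\<integral>\<^sup>+x. ennreal (weight \<sigma> a b n k x) \<partial>lebesgue_on {a..b}) \<le> ennreal (B / real n)"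
      using weight_nn_integral_le[OF n] by (subst nn_integral_restrict_space) (auto simp: B_def)
  qed auto
  also have "\<dots> = (\<Sum>k\<in>?J. ennreal B * (\<integral>\<^sup>+x. ennreal (\<psi> (h x)) * indicator (cell n k) x \<partial>lebesgue_on {a..b}))"
  proof (rule sum.cong[OF refl])
    fix k
    have nB: "ennreal (real n) * ennreal (B / real n) = ennreal B"
      using n B by (subst ennreal_mult[symmetric]) auto
    show "(ennreal (real n) * (\<integral>\<^sup>+x. ennreal (\<psi> (h x)) * indicator (cell n k) x \<partial>lebesgue_on {a..b}))
      * ennreal (B / real n) = ennreal B * (\<integral>\<^sup>+x. ennreal (\<psi> (h x)) * indicator (cell n k) x \<partial>lebesgue_on {a..b})"
      unfolding nB[symmetric] by (simp only: mult_ac)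
  qed
  also have "\<dots> = ennreal B * (\<integral>\<^sup>+x. ennreal (\<psi> (h x)) * (\<Sum>k\<in>?J. indicator (cell n k) x) \<partial>lebesgue_on {a..b})"
  proof -
    have "(\<lambda>x. indicator (cell n k) x :: ennreal) \<in> borel_measurable (lebesgue_on {a..b})" for k
      by (intro measurable_restrict_space1 borel_measurable_indicator) (simp add: cell_def)
    then have "(\<lambda>x. ennreal (\<psi> (h x)) * indicator (cell n k) x) \<in> borel_measurable (lebesgue_on {a..b})" for k
      using psih by (intro borel_measurable_times_ennreal measurable_compose[OF _ measurable_ennreal])
    then show ?thesis
      by (simp only: sum_distrib_left nn_integral_sum)
  qed
  also have "\<dots> \<le> ennreal B * (\<integral>\<^sup>+x. ennreal (\<psi> (h x)) * 2 \<partial>lebesgue_on {a..b})"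
    using cells_overlap_le_2[OF n] by (intro mult_left_mono nn_integral_mono) auto
  also have "\<dots> = ennreal (2 * B) * (\<integral>\<^sup>+x. ennreal (\<psi> (h x)) \<partial>lebesgue_on {a..b})"
  proof -
    have "ennreal (2 * B) = 2 * ennreal B"
      using B by (simp add: ennreal_mult)
    moreover have "(\<lambda>x. ennreal (\<psi> (h x))) \<in> borel_measurable (lebesgue_on {a..b})"
      using psih by simp
    ultimately show ?thesis
      by (simp only: nn_integral_multc) (simp only: mult_ac)
  qed
  finally show ?thesis unfolding B_def .
qed

end

section \<open>Convergence for continuous functions\<close>

lemma eventually_le_real_mult:
  fixes c R :: real
  assumes "0 < c"
  shows "\<forall>\<^sub>F n in sequentially. R \<le> real n * c"
proof -
  have "filterlim (\<lambda>n. real n * c) at_top sequentially"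
    by (rule filterlim_at_top_mult_tendsto_pos[OF tendsto_const assms filterlim_real_sequentially])
  then show ?thesis by (simp add: filterlim_at_top)
qed

lemma eventually_index_set_nonempty:
  assumes "a < b"
  shows "\<forall>\<^sub>F n in sequentially. 0 < n \<and> index_set a b n \<noteq> {}"
proof -
  have "\<forall>\<^sub>F n in sequentially. 2 \<le> real n * (b - a)"
    by (rule eventually_le_real_mult) (use assms in simp)
  with eventually_gt_at_top[of 0] show ?thesis
  proof eventually_elim
    case (elim n)
    have "\<lceil>real n * a\<rceil> \<in> index_set a b n"
      using elim by (simp add: index_set_iff right_diff_distrib) linarith
    then show ?case using elim by auto
  qed
qed

context sigmoidal_kernel
begin

lemma weight_eq_1:
  assumes "0 < n" "index_set a b n \<noteq> {}" "a \<le> x" "real n * x < of_int \<lfloor>real n * b\<rfloor>"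
  obtains k where "k \<in> index_set a b n" "weight \<sigma> a b n k x = 1"
proof -
  let ?J = "index_set a b n"
  have "(MAX j\<in>?J. phi_sigma \<sigma> (real n * x - of_int j)) \<in> (\<lambda>j. phi_sigma \<sigma> (real n * x - of_int j)) ` ?J"
    by (rule Max_in) (use assms in auto)
  moreover have "0 < (MAX j\<in>?J. phi_sigma \<sigma> (real n * x - of_int j))"
    by (rule less_le_trans[OF kernel_1_pos kernel_max_ge]) (use assms in auto)
  ultimately show ?thesis
    by (auto intro!: that simp: weight_def)
qed

text \<open>
  Call an index near if it is within \<open>R\<close> of \<open>n x\<close>. For large \<open>n\<close> the near cells lie in a small
  neighbourhood of \<open>x\<close>, so their means are close to \<open>g x\<close>; the weights of the far cells are at most
  \<open>phi_sigma \<sigma> R / phi_sigma \<sigma> 1\<close>. Choosing \<open>R\<close> so that this is below \<open>1\<close> forces an index of weight \<open>1\<close>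
  to be near, which gives the lower bound; choosing it also below \<open>e / (M + 1)\<close> makes the far terms
  irrelevant for the upper bound.
\<close>

lemma kantorovich_tendsto_at_continuity_point:
  assumes g: "integrable (lebesgue_on {a..b}) g"
    and bounds: "\<And>u. u \<in> {a..b} \<Longrightarrow> 0 \<le> g u" "\<And>u. u \<in> {a..b} \<Longrightarrow> g u \<le> M"
    and x: "a \<le> x" "x < b" and cont: "isCont g x"
  shows "(\<lambda>n. max_product_kantorovich \<sigma> a b n g x) \<longlonglongrightarrow> g x"
proof (rule tendstoI)
  fix e' :: real assume "0 < e'"
  define e where "e = e' / 2"
  have e: "0 < e" "e < e'" using \<open>0 < e'\<close> by (auto simp: e_def)
  have M: "0 \<le> M" using bounds[of x] x by auto
  obtain d where d: "0 < d" "\<And>u. \<bar>u - x\<bar> < d \<Longrightarrow> \<bar>g u - g x\<bar> < e"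
    using cont e(1) unfolding continuous_at_eps_delta by (auto simp: dist_real_def)
  have "\<forall>\<^sub>F t in at_top. phi_sigma \<sigma> t < min (phi_sigma \<sigma> 1) (e * phi_sigma \<sigma> 1 / (M + 1))"
    by (rule order_tendstoD(2)[OF kernel_tendsto_0]) (use e M kernel_1_pos in auto)
  then obtain R where R: "0 \<le> R" "phi_sigma \<sigma> R < phi_sigma \<sigma> 1"
      "phi_sigma \<sigma> R < e * phi_sigma \<sigma> 1 / (M + 1)"
    unfolding eventually_at_top_linorder by (metis max.cobounded1 max.cobounded2 min_less_iff_conj)
  have "\<forall>\<^sub>F n in sequentially. R + 2 \<le> real n * d" "\<forall>\<^sub>F n in sequentially. 2 \<le> real n * (b - x)"
    using d x by (auto intro!: eventually_le_real_mult)
  moreover have "\<forall>\<^sub>F n in sequentially. 0 < n \<and> index_set a b n \<noteq> {}"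
    by (rule eventually_index_set_nonempty) (use x in simp)
  ultimately show "\<forall>\<^sub>F n in sequentially. dist (max_product_kantorovich \<sigma> a b n g x) (g x) < e'"
  proof eventually_elim
    case (elim n)
    then have n: "0 < n" and J: "index_set a b n \<noteq> {}" by auto
    have xb: "real n * x < of_int \<lfloor>real n * b\<rfloor>"
      using elim(2) by (simp add: right_diff_distrib) linarith
    have mean_bounds: "0 \<le> cell_mean g n k" "cell_mean g n k \<le> M" if "k \<in> index_set a b n" for k
      using cell_mean_bounds[OF n set_integrable_cell[OF g n that], of 0 M] cell_subset[OF n that] bounds
      by blast+
    have near: "g x - e \<le> cell_mean g n k" "cell_mean g n k \<le> g x + e"
      if k: "k \<in> index_set a b n" "\<bar>real n * x - of_int k\<bar> \<le> R" for k
    proof -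
      have "\<bar>g u - g x\<bar> < e" if "u \<in> cell n k" for u
      proof (rule d(2))
        have "of_int k \<le> real n * u" "real n * u \<le> of_int k + 1"
          using that n by (auto simp: cell_def field_simps)
        then have "real n * (u - x) < real n * d" "real n * (x - u) < real n * d"
          using k(2) elim(1) by (auto simp: right_diff_distrib)
        then show "\<bar>u - x\<bar> < d" using n by (simp add: abs_less_iff)
      qed
      then have "\<And>u. u \<in> cell n k \<Longrightarrow> g x - e \<le> g u" "\<And>u. u \<in> cell n k \<Longrightarrow> g u \<le> g x + e"
        by (fastforce simp: abs_less_iff)+
      then show "g x - e \<le> cell_mean g n k" "cell_mean g n k \<le> g x + e"
        using cell_mean_bounds[OF n set_integrable_cell[OF g n k(1)]] by blast+
    qed
    have far: "weight \<sigma> a b n k x \<le> phi_sigma \<sigma> R / phi_sigma \<sigma> 1"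
      if k: "k \<in> index_set a b n" "R < \<bar>real n * x - of_int k\<bar>" for k
    proof -
      have "phi_sigma \<sigma> (real n * x - of_int k) \<le> phi_sigma \<sigma> R"
        by (rule kernel_antimono) (use R k in auto)
      then show ?thesis
        using weight_le_kernel[OF n k(1) x(1) xb] kernel_1_pos
        by (meson divide_right_mono less_imp_le order_trans)
    qed
    have "max_product_kantorovich \<sigma> a b n g x \<le> g x + e"
      unfolding kantorovich_eq_Max[OF J]
    proof (subst Max_le_iff, simp_all add: J, intro ballI)
      fix k assume k: "k \<in> index_set a b n"
      show "cell_mean g n k * weight \<sigma> a b n k x \<le> g x + e"
      proof (cases "\<bar>real n * x - of_int k\<bar> \<le> R")
        case True
        have "cell_mean g n k * weight \<sigma> a b n k x \<le> cell_mean g n k * 1"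
          by (rule mult_left_mono) (use mean_bounds weight_le_1 k in auto)
        then show ?thesis using near(2)[OF k True] by simp
      next
        case False
        have "cell_mean g n k * weight \<sigma> a b n k x \<le> M * (phi_sigma \<sigma> R / phi_sigma \<sigma> 1)"
          by (rule mult_mono) (use mean_bounds k far weight_nonneg False M in auto)
        also have "\<dots> \<le> (M + 1) * (phi_sigma \<sigma> R / phi_sigma \<sigma> 1)"
          by (rule mult_right_mono) (use kernel_nonneg in auto)
        also have "\<dots> \<le> e"
          using R(3) M kernel_1_pos by (simp add: field_simps)
        also have "\<dots> \<le> g x + e" using bounds(1)[of x] x by auto
        finally show ?thesis .
      qed
    qed
    moreover have "g x - e \<le> max_product_kantorovich \<sigma> a b n g x"
    proof -
      obtain k where k: "k \<in> index_set a b n" "weight \<sigma> a b n k x = 1"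
        using weight_eq_1[OF n J x(1) xb] by blast
      have "phi_sigma \<sigma> R / phi_sigma \<sigma> 1 < 1" using R kernel_1_pos by simp
      then have "\<bar>real n * x - of_int k\<bar> \<le> R"
        using far[OF k(1)] k(2) by (cases "\<bar>real n * x - of_int k\<bar> \<le> R") auto
      then have "g x - e \<le> cell_mean g n k * weight \<sigma> a b n k x"
        using near(1)[OF k(1)] k(2) by simp
      also have "\<dots> \<le> max_product_kantorovich \<sigma> a b n g x"
        unfolding kantorovich_eq_Max[OF J] by (rule Max_ge) (simp, rule imageI, rule k(1))
      finally show ?thesis .
    qed
    ultimately show ?case using e by (simp add: dist_real_def abs_if)
  qed
qed

text \<open>
  Dominated convergence: the operators preserve the bounds \<open>0\<close> and \<open>M\<close>, and pointwise convergence holds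
  except possibly at \<open>b\<close>.
\<close>

lemma kantorovich_modular_tendsto_continuous:
  fixes \<psi> g :: "real \<Rightarrow> real"
  assumes "a < b" and g: "continuous_on UNIV g" and bounds: "\<And>u. 0 \<le> g u" "\<And>u. g u \<le> M"
    and \<psi>: "continuous_on UNIV \<psi>" "\<psi> 0 = 0" "\<And>u v. \<bar>u\<bar> \<le> \<bar>v\<bar> \<Longrightarrow> \<psi> u \<le> \<psi> v"
  shows "(\<lambda>n. \<integral>\<^sup>+x. ennreal (\<psi> (max_product_kantorovich \<sigma> a b n g x - g x)) \<partial>lebesgue_on {a..b}) \<longlonglongrightarrow> 0"
proof -
  let ?M = "lebesgue_on {a..b}"
  have M: "0 \<le> M" using order_trans[OF bounds(1) bounds(2)] .
  have gm: "g \<in> borel_measurable ?M"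
    by (intro borel_measurable_lebesgue_onI borel_measurable_continuous_onI g)
  have gi: "integrable ?M g"
    by (rule finite_measure.integrable_const_bound[where B = M])
      (use gm bounds in \<open>auto intro!: finite_measure_lebesgue_on\<close>)
  \<comment> \<open>While the index set is empty the operator has no meaningful value, so the sequence is shifted past these \<open>n\<close>.\<close>
  obtain N where N: "\<And>n. N \<le> n \<Longrightarrow> 0 < n \<and> index_set a b n \<noteq> {}"
    using eventually_index_set_nonempty[OF \<open>a < b\<close>] unfolding eventually_sequentially by blast
  have "(\<lambda>n. \<integral>\<^sup>+x. ennreal (\<psi> (max_product_kantorovich \<sigma> a b (n + N) g x - g x)) \<partial>?M)
      \<longlonglongrightarrow> (\<integral>\<^sup>+x. 0 \<partial>?M)"
  proof (rule nn_integral_dominated_convergence[where w = "\<lambda>_. ennreal (\<psi> M)"])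
    fix n
    have n: "0 < n + N" "index_set a b (n + N) \<noteq> {}" using N[of "n + N"] by auto
    have "max_product_kantorovich \<sigma> a b (n + N) g \<in> borel_measurable ?M"
      by (rule borel_measurable_lebesgue_onI) (simp add: kantorovich_measurable n)
    then have "(\<lambda>x. max_product_kantorovich \<sigma> a b (n + N) g x - g x) \<in> borel_measurable ?M"
      using gm by simp
    then show "(\<lambda>x. ennreal (\<psi> (max_product_kantorovich \<sigma> a b (n + N) g x - g x))) \<in> borel_measurable ?M"
      by (intro measurable_compose[OF _ measurable_ennreal] measurable_compose[OF _ borel_measurable_continuous_onI[OF \<psi>(1)]])
    have "0 \<le> cell_mean g (n + N) k" "cell_mean g (n + N) k \<le> M" if "k \<in> index_set a b (n + N)" for k
      using cell_mean_bounds[OF n(1) set_integrable_cell[OF gi n(1) that] bounds] by auto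
    note K = kantorovich_bounds[OF n(2) this]
    have "\<bar>max_product_kantorovich \<sigma> a b (n + N) g x - g x\<bar> \<le> \<bar>M\<bar>" for x
      using bounds[of x] K[of x] M by linarith
    then show "AE x in ?M. ennreal (\<psi> (max_product_kantorovich \<sigma> a b (n + N) g x - g x)) \<le> ennreal (\<psi> M)"
      by (intro AE_I2 ennreal_leI \<psi>(3))
  next
    show "AE x in ?M. (\<lambda>n. ennreal (\<psi> (max_product_kantorovich \<sigma> a b (n + N) g x - g x))) \<longlonglongrightarrow> 0"
      using AE_lebesgue_on_Ico[of a b]
    proof eventually_elim
      case (elim x)
      have "(\<lambda>n. max_product_kantorovich \<sigma> a b n g x) \<longlonglongrightarrow> g x"
        by (rule kantorovich_tendsto_at_continuity_point[OF gi])
          (use elim bounds g in \<open>auto simp: continuous_on_eq_continuous_at\<close>)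
      then have "(\<lambda>n. max_product_kantorovich \<sigma> a b (n + N) g x - g x) \<longlonglongrightarrow> 0"
        by (intro LIM_zero LIMSEQ_ignore_initial_segment)
      then have "(\<lambda>n. \<psi> (max_product_kantorovich \<sigma> a b (n + N) g x - g x)) \<longlonglongrightarrow> \<psi> 0"
        by (rule continuous_on_tendsto_compose[OF \<psi>(1)]) auto
      from tendsto_ennrealI[OF this] show ?case
        by (simp add: \<psi>(2))
    qed
  qed (simp, simp, rule nn_integral_const_lebesgue_on_Icc)
  then show ?thesis
    using LIMSEQ_offset[of _ N] by simp
qed

end

section \<open>Modular convergence on the Orlicz class\<close>

theorem theorem4p5:
  fixes a b :: real and \<sigma> \<phi> f :: "real \<Rightarrow> real"
  assumes "a < b"
    and "mono \<sigma>" and "sigmoidal \<sigma>"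
    and "Sigma1 \<sigma>" and "Sigma2 \<sigma>" and "Sigma3 \<sigma>"
    and "phi_function \<phi>" and "convex_on {0..} \<phi>"
    and "f \<in> orlicz_space_nonneg \<phi> a b"
  shows "\<exists>c>0. (\<lambda>n. modular \<phi> a b (\<lambda>x. c * (max_product_kantorovich \<sigma> a b n f x - f x)))
           \<longlonglongrightarrow> 0"
proof -
  interpret sigmoidal_kernel \<sigma>
    using assms by unfold_locales
  let ?M = "lebesgue_on {a..b}" and ?K = "max_product_kantorovich \<sigma> a b"
  note ext = phi_function_even_extension[OF \<open>phi_function \<phi>\<close> \<open>convex_on {0..} \<phi>\<close>]
  from assms(9) obtain c\<^sub>0 where f: "f \<in> borel_measurable ?M" "\<And>x. x \<in> {a..b} \<Longrightarrow> 0 \<le> f x"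
    and c0: "0 < c\<^sub>0" "(\<integral>\<^sup>+x. ennreal (\<phi> \<bar>c\<^sub>0 * f x\<bar>) \<partial>?M) < \<infinity>"
    by (auto simp: orlicz_space_nonneg_def orlicz_space_def modular_def)
  \<comment> \<open>Half of \<open>c\<^sub>0\<close>, since the approximation lemma needs \<open>\<psi> (2 f)\<close> to be integrable.\<close>
  define \<psi> where "\<psi> u = \<phi> \<bar>c\<^sub>0 / 2 * u\<bar>" for u
  have conv: "convex_on UNIV \<psi>"
  proof (rule convex_onI)
    fix t u v :: real assume t: "0 < t" "t < 1"
    have eq: "c\<^sub>0 / 2 * ((1 - t) *\<^sub>R u + t *\<^sub>R v)
        = (1 - t) *\<^sub>R (c\<^sub>0 / 2 * u) + t *\<^sub>R (c\<^sub>0 / 2 * v)"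
      by (simp add: field_simps)
    show "\<psi> ((1 - t) *\<^sub>R u + t *\<^sub>R v) \<le> (1 - t) * \<psi> u + t * \<psi> v"
      unfolding \<psi>_def eq by (rule convex_onD[OF ext(1)]) (use t in auto)
  qed simp
  have zero: "\<psi> 0 = 0"
    using assms(7) by (simp add: \<psi>_def phi_function_def)
  have nonneg: "0 \<le> \<psi> u" for u
    unfolding \<psi>_def by (rule ext(3))
  have mono: "\<psi> u \<le> \<psi> v" if "\<bar>u\<bar> \<le> \<bar>v\<bar>" for u v
    unfolding \<psi>_def using that c0(1) by (intro ext(4)) (simp add: abs_mult mult_left_mono)
  have cont: "continuous_on UNIV \<psi>"
    by (rule convex_on_continuous[OF open_UNIV conv])
  have fin: "(\<integral>\<^sup>+x. ennreal (\<psi> (2 * f x)) \<partial>?M) < \<infinity>"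
    using c0(2) by (simp add: \<psi>_def)
  have psi_meas: "(\<lambda>x. ennreal (\<psi> (h x))) \<in> borel_measurable ?M" if "h \<in> borel_measurable ?M" for h
    using measurable_compose[OF that borel_measurable_continuous_onI[OF cont]] by simp
  have fi: "integrable ?M f"
    by (rule finite_modular_imp_integrable[OF assms(7,8) f c0])
  define B where "B = 2 * (1 / phi_sigma \<sigma> 1 + 1)"
  have B: "0 < B" using kernel_1_pos by (simp add: B_def add_pos_pos)
  have "(\<lambda>n. modular \<phi> a b (\<lambda>x. c\<^sub>0 / 6 * (?K n f x - f x))) \<longlonglongrightarrow> 0"
  proof (rule order_tendstoI)
    fix E :: ennreal assume "0 < E"
    then obtain e' :: real where e': "0 < e'" "ennreal e' < E"
    proof (cases E)
      case (real r)
      then show ?thesis using \<open>0 < E\<close> that[of "r / 2"] by (simp add: ennreal_less_iff)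
    next
      case top
      then show ?thesis using that[of 1] by simp
    qed
    \<comment> \<open>The three errors below are at most \<open>B e\<close>, \<open>e\<close> and \<open>e\<close>.\<close>
    define e where "e = e' / (B + 2)"
    have e: "0 < e" "(B + 2) * e = e'" using e' B by (auto simp: e_def)
    obtain g M where g: "continuous_on UNIV g" "\<And>x. 0 \<le> g x" "\<And>x. g x \<le> M"
      and fg: "(\<integral>\<^sup>+x. ennreal (\<psi> (f x - g x)) \<partial>?M) < ennreal e"
      using continuous_modular_approximation[OF f conv zero nonneg mono fin e(1)] by metis
    have gm: "g \<in> borel_measurable ?M"
      by (intro borel_measurable_lebesgue_onI borel_measurable_continuous_onI g(1))
    have gi: "integrable ?M g"
      by (rule finite_measure.integrable_const_bound[where B = M])
        (use gm g in \<open>auto intro!: finite_measure_lebesgue_on\<close>)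
    define h where "h x = \<bar>f x - g x\<bar>" for x
    have hi: "integrable ?M h" unfolding h_def[abs_def] using fi gi by simp
    have psih: "\<psi> (h x) = \<psi> (f x - g x)" for x
      by (rule antisym) (auto simp: h_def intro: mono)
    have "\<forall>\<^sub>F n in sequentially. (\<integral>\<^sup>+x. ennreal (\<psi> (?K n g x - g x)) \<partial>?M) < ennreal e"
      using kantorovich_modular_tendsto_continuous[OF \<open>a < b\<close> g cont zero mono] e(1)
      by (intro order_tendstoD(2)) auto
    then show "\<forall>\<^sub>F n in sequentially. modular \<phi> a b (\<lambda>x. c\<^sub>0 / 6 * (?K n f x - f x)) < E"
      using eventually_index_set_nonempty[OF \<open>a < b\<close>]
    proof eventually_elim
      case (elim n)
      then have n: "0 < n" and J: "index_set a b n \<noteq> {}" by auto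
      have Km: "?K n u \<in> borel_measurable ?M" for u
        by (rule borel_measurable_lebesgue_onI) (simp add: kantorovich_measurable J)
      have means: "cell_mean f n k \<le> cell_mean g n k + cell_mean h n k"
          "cell_mean g n k \<le> cell_mean f n k + cell_mean h n k" if "k \<in> index_set a b n" for k
        using that by (auto intro!: cell_mean_le_add set_integrable_cell[OF _ n] fi gi hi simp: h_def)
      have diff: "\<bar>?K n f x - ?K n g x\<bar> \<le> ?K n h x" for x
        using kantorovich_le_add[OF J means(1), of x] kantorovich_le_add[OF J means(2), of x]
        by (simp add: abs_le_iff)
      have bound: "\<phi> \<bar>c\<^sub>0 / 6 * (?K n f x - f x)\<bar> \<le> \<psi> (?K n h x) + \<psi> (?K n g x - g x) + \<psi> (h x)" for x
      proof -
        have "\<phi> \<bar>c\<^sub>0 / 6 * (?K n f x - f x)\<bar>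
            = \<psi> (((?K n f x - ?K n g x) + (?K n g x - g x) + (g x - f x)) / 3)"
        proof -
          have "c\<^sub>0 / 2 * (((?K n f x - ?K n g x) + (?K n g x - g x) + (g x - f x)) / 3)
              = c\<^sub>0 / 6 * (?K n f x - f x)"
            by (simp add: field_simps)
          then show ?thesis unfolding \<psi>_def by (simp only:)
        qed
        also have "\<dots> \<le> (\<psi> (?K n f x - ?K n g x) + \<psi> (?K n g x - g x) + \<psi> (g x - f x)) / 3"
          by (rule convex_mean3_le[OF conv])
        also have "\<dots> \<le> \<psi> (?K n f x - ?K n g x) + \<psi> (?K n g x - g x) + \<psi> (g x - f x)"
          using nonneg[of "?K n f x - ?K n g x"] nonneg[of "?K n g x - g x"] nonneg[of "g x - f x"]
          by simp
        also have "\<dots> \<le> \<psi> (?K n h x) + \<psi> (?K n g x - g x) + \<psi> (h x)"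
          using diff[of x] by (intro add_mono mono order_refl) (auto simp: h_def)
        finally show ?thesis .
      qed
      have "modular \<phi> a b (\<lambda>x. c\<^sub>0 / 6 * (?K n f x - f x))
          \<le> (\<integral>\<^sup>+x. ennreal (\<psi> (?K n h x)) + ennreal (\<psi> (?K n g x - g x)) + ennreal (\<psi> (h x)) \<partial>?M)"
        unfolding modular_def
      proof (rule nn_integral_mono)
        fix x
        have "ennreal (\<phi> \<bar>c\<^sub>0 / 6 * (?K n f x - f x)\<bar>)
            \<le> ennreal (\<psi> (?K n h x) + \<psi> (?K n g x - g x) + \<psi> (h x))"
          using bound[of x] by (rule ennreal_leI)
        then show "ennreal (\<phi> \<bar>c\<^sub>0 / 6 * (?K n f x - f x)\<bar>)
            \<le> ennreal (\<psi> (?K n h x)) + ennreal (\<psi> (?K n g x - g x)) + ennreal (\<psi> (h x))"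
          using nonneg by (simp add: ennreal_plus)
      qed
      also have "\<dots> = (\<integral>\<^sup>+x. ennreal (\<psi> (?K n h x)) \<partial>?M)
          + (\<integral>\<^sup>+x. ennreal (\<psi> (?K n g x - g x)) \<partial>?M) + (\<integral>\<^sup>+x. ennreal (\<psi> (h x)) \<partial>?M)"
      proof -
        have "(\<lambda>x. ?K n g x - g x) \<in> borel_measurable ?M" using Km gm by simp
        note m = psi_meas[OF Km[of h]] psi_meas[OF this] psi_meas[OF borel_measurable_integrable[OF hi]]
        show ?thesis
          unfolding nn_integral_add[OF borel_measurable_add[OF m(1,2)] m(3)] nn_integral_add[OF m(1,2)] ..
      qed
      also have "\<dots> \<le> ennreal B * (\<integral>\<^sup>+x. ennreal (\<psi> (h x)) \<partial>?M)
          + (\<integral>\<^sup>+x. ennreal (\<psi> (?K n g x - g x)) \<partial>?M) + (\<integral>\<^sup>+x. ennreal (\<psi> (h x)) \<partial>?M)"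
        unfolding B_def
        by (intro add_mono order_refl kantorovich_modular_le conv zero nonneg hi n J)
      also have "\<dots> \<le> ennreal B * ennreal e + ennreal e + ennreal e"
        using fg elim(1) by (intro add_mono mult_left_mono) (auto simp: psih)
      also have "\<dots> = ennreal ((B + 2) * e)"
      proof -
        have "(B + 2) * e = B * e + e + e" by (simp add: algebra_simps)
        then show ?thesis
          using B e(1)
          by (simp only: ennreal_plus ennreal_mult mult_nonneg_nonneg add_nonneg_nonneg less_imp_le)
      qed
      also have "\<dots> < E" using e(2) e'(2) by simp
      finally show ?case .
    qed
  qed simp
  moreover have "0 < c\<^sub>0 / 6" using c0(1) by simp
  ultimately show ?thesis by blast
qed

end
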